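(* Let $n$ be a positive integer and let $L(x)=(1-n^nx)^{-1/n}\in\mathbb Z[[x]]$. The first three coefficients $\mu(x)$, $\Phi_0(x)$, $\Phi_1(x)$ in the expansion $$\mathcal F(w,x)\sim e^{\mu(x)w}\sum_{s=0}^{\infty}\Phi_s(x)\,w^{-s}\qquad(w\to\infty)$$ are given by $$\mu(x)=\int_0^x\frac{L(u)-1}{u}\,du,\qquad \Phi_0(x)=L(x),\qquad \Phi_1(x)=\frac{(n-2)(n+1)}{24n}\,\big(L(x)-L(x)^n\big).$$
   Context: For the fixed positive integer $n$, $$\mathcal F(w,x)=\sum_{d=0}^{\infty}x^d\,\frac{\prod_{r=1}^{nd}(nw+r)}{\prod_{r=1}^{d}\big((w+r)^n-w^n\big)}\in 1+x\,\mathbb Q(w)[[x]].$$ Each coefficient of the power series (in $x$) $\log\mathcal F(w,x)\in\mathbb Q(w)[[x]]$ is a rational function of $w$ which is $O(w)$ as $w\to\infty$. Expanding each such coefficient in powers of $w^{-1}$ at $w=\infty$, one gets an expansion $\log\mathcal F(w,x)\sim\sum_{j=-1}^{\infty}\mu_j(x)w^{-j}$ with $\mu_j(x)\in x\,\mathbb Q[[x]]$. Exponentiating, with $\mu=\mu_{-1}$, gives the asymptotic expansion $\mathcal F(w,x)\sim e^{\mu(x)w}\sum_{s\ge0}\Phi_s(x)w^{-s}$, which defines the power series $\mu\in x\,\mathbb Q[[x]]$ and $\Phi_s\in\mathbb Q[[x]]$ (so $\Phi_0=e^{\mu_0}$, $\Phi_1=\Phi_0\mu_1$, etc.). The relation $\sim$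 is understood coefficientwise in $x$, each coefficient being expanded as a Laurent series in $w^{-1}$. The integral $\int_0^x$ is the formal termwise integral of a power series. *)

theory Defs
  imports "HOL-Computational_Algebra.Computational_Algebra"
begin

definition ratw :: "rat poly fract" where
  "ratw = to_fract [:0, 1:]"

definition calF :: "nat \<Rightarrow> rat poly fract fps" where
  "calF n = Abs_fps (\<lambda>d.
     (\<Prod>r = 1..n * d. of_nat n * ratw + of_nat r) /
     (\<Prod>r = 1..d. (ratw + of_nat r) ^ n - ratw ^ n))"

text \<open>
  Since the constant term of \<^term>\<open>calF n\<close> is 1, its logarithm is the composition of
  \<open>log (1 + y)\<close> with \<open>y = calF n - 1\<close>.
\<close>

definition log_calF :: "nat \<Rightarrow> rat poly fract fps" where
  "log_calF n = fps_ln 1 oo (calF n - 1)"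

text \<open>
  Laurent expansion at \<open>w = \<infinity>\<close>.  The formal variable \<^term>\<open>fls_X\<close> of the target is
  \<open>w\<^sup>-\<^sup>1\<close>, so \<open>w\<close> is sent to \<^term>\<open>fls_X_inv\<close> and the coefficient of \<open>w\<^sup>-\<^sup>j\<close> is the one with
  index \<open>j\<close>.
\<close>

definition poly_at_infinity :: "rat poly \<Rightarrow> rat fls" where
  "poly_at_infinity p = poly (map_poly fls_const p) fls_X_inv"

lemma poly_at_infinity_mult:
  "poly_at_infinity (p * q) = poly_at_infinity p * poly_at_infinity q"
proof -
  have "map_poly fls_const (p * q) = map_poly fls_const p * (map_poly fls_const q :: rat fls poly)"
    by (rule poly_eqI)
      (simp add: coeff_map_poly coeff_mult fls_eq_iff fls_nth_sum)
  then show ?thesis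
    by (simp add: poly_at_infinity_def)
qed

lemma poly_at_infinity_nth: "fls_nth (poly_at_infinity p) (- int k) = coeff p k"
proof -
  have deg: "degree (map_poly fls_const p :: rat fls poly) = degree p"
    by (rule degree_map_poly) auto
  have "fls_nth (poly_at_infinity p) (- int k) =
      fls_nth (\<Sum>i\<le>degree p. fls_const (coeff p i) * fls_X_inv ^ i) (- int k)"
    by (simp add: poly_at_infinity_def poly_altdef deg coeff_map_poly)
  also have "\<dots> = (\<Sum>i\<le>degree p. if i = k then coeff p i else 0)"
    unfolding fls_nth_sum by (rule sum.cong) auto
  also have "\<dots> = coeff p k"
    by (simp add: coeff_eq_0)
  finally show ?thesis .
qed

lemma poly_at_infinity_eq_0_iff: "poly_at_infinity p = 0 \<longleftrightarrow> p = 0"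
proof
  assume "poly_at_infinity p = 0"
  then have "coeff p k = 0" for k
    using poly_at_infinity_nth[of p k] by simp
  then show "p = 0"
    by (simp add: poly_eq_iff)
qed (simp add: poly_at_infinity_def)

text \<open>The choice of the fraction representing \<open>f\<close> is immaterial, see \<open>expand_at_infinity_Fract\<close>.\<close>

definition expand_at_infinity :: "rat poly fract \<Rightarrow> rat fls" where
  "expand_at_infinity f =
     (THE y. \<exists>p q. q \<noteq> 0 \<and> f = Fract p q \<and> y = poly_at_infinity p / poly_at_infinity q)"

lemma expand_at_infinity_Fract:
  assumes "q \<noteq> 0"
  shows "expand_at_infinity (Fract p q) = poly_at_infinity p / poly_at_infinity q"
  unfolding expand_at_infinity_def
proof (rule the_equality)
  fix y
  assume "\<exists>p' q'. q' \<noteq> 0 \<and> Fract p q = Fract p' q' \<and>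
      y = poly_at_infinity p' / poly_at_infinity q'"
  then obtain p' q' where q': "q' \<noteq> 0" and "Fract p q = Fract p' q'"
      and y: "y = poly_at_infinity p' / poly_at_infinity q'"
    by blast
  then have "p * q' = p' * q"
    using assms by (simp add: eq_fract)
  then have "poly_at_infinity p * poly_at_infinity q' = poly_at_infinity p' * poly_at_infinity q"
    by (simp flip: poly_at_infinity_mult)
  then show "y = poly_at_infinity p / poly_at_infinity q"
    using assms q' by (simp add: y frac_eq_eq poly_at_infinity_eq_0_iff)
qed (use assms in blast)

definition mu_coeff :: "nat \<Rightarrow> int \<Rightarrow> rat fps" where
  "mu_coeff n j = Abs_fps (\<lambda>d. fls_nth (expand_at_infinity (fps_nth (log_calF n) d)) j)"

text \<open>
  The series \<open>\<Sum>\<^sub>s f\<^sub>s(x) w\<^sup>-\<^sup>s\<close>, as a power series in \<open>x\<close> over the Laurent series in \<open>w\<^sup>-\<^sup>1\<close>.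
\<close>

definition winv_series :: "(nat \<Rightarrow> rat fps) \<Rightarrow> rat fls fps" where
  "winv_series f = Abs_fps (\<lambda>d. fps_to_fls (Abs_fps (\<lambda>s. fps_nth (f s) d)))"

definition mu :: "nat \<Rightarrow> rat fps" where
  "mu n = mu_coeff n (-1)"

text \<open>
  \<open>\<Sum>\<^sub>s \<Phi>\<^sub>s(x) w\<^sup>-\<^sup>s = exp (\<Sum>\<^sub>j\<^sub>\<ge>\<^sub>0 \<mu>\<^sub>j(x) w\<^sup>-\<^sup>j)\<close>, where the exponent has zero constant term in \<open>x\<close>.
\<close>

definition Phi :: "nat \<Rightarrow> nat \<Rightarrow> rat fps" where
  "Phi n s = Abs_fps (\<lambda>d.
     fls_nth (fps_nth (fps_exp 1 oo winv_series (\<lambda>j. mu_coeff n (int j))) d) (int s))"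

text \<open>
  \<open>f(w,x) \<sim> exp (m(x) w) \<Sum>\<^sub>s \<phi>\<^sub>s(x) w\<^sup>-\<^sup>s\<close>, coefficientwise in \<open>x\<close>.  The first conjunct makes the
  composition with \<^term>\<open>fps_exp 1\<close> the actual exponential.
\<close>

definition has_expansion :: "rat poly fract fps \<Rightarrow> rat fps \<Rightarrow> (nat \<Rightarrow> rat fps) \<Rightarrow> bool" where
  "has_expansion f m \<phi> \<longleftrightarrow>
     fps_nth m 0 = 0 \<and>
     Abs_fps (\<lambda>d. expand_at_infinity (fps_nth f d)) =
       (fps_exp 1 oo Abs_fps (\<lambda>d. fls_const (fps_nth m d) * fls_X_inv)) * winv_series \<phi>"

text \<open>\<open>L(x) = (1 - n\<^sup>n x)\<^sup>-\<^sup>1\<^sup>/\<^sup>n\<close>, by the binomial series.\<close>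

definition L_series :: "nat \<Rightarrow> rat fps" where
  "L_series n = fps_binomial (- 1 / of_nat n) oo (- fps_const (of_nat n ^ n) * fps_X)"

end

theory Submission
  imports Defs
begin

text \<open>
  With \<open>D\<^sub>w = w + x d/dx\<close>, the series \<open>F\<close> satisfies
  \<open>(D\<^sub>w\<^sup>n - w\<^sup>n) F = x (n D\<^sub>w + 1) \<dots> (n D\<^sub>w + n) F\<close>.  In terms of
  \<open>Y = w\<^sup>-\<^sup>1 F\<^sup>-\<^sup>1 D\<^sub>w F = 1 + w\<^sup>-\<^sup>1 x d/dx log F\<close> this is a Riccati equation whose coefficients are
  polynomials in \<open>w\<^sup>-\<^sup>1\<close>.  The coefficient of \<open>x\<^sup>d\<close> in \<open>Y\<close> enters the coefficient of \<open>x\<^sup>d\<close> in the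
  equation linearly, with factor \<open>\<Sum>\<^sub>i\<^sub><\<^sub>n (1 + d/w)\<^sup>i\<close>, a unit of \<open>\<rat>[[w\<^sup>-\<^sup>1]]\<close>.  Hence \<open>Y\<close> has coefficients
  in \<open>\<rat>[[w\<^sup>-\<^sup>1]]\<close>, so that \<open>log F\<close> is \<open>O(w)\<close>, and the orders 0, 1, 2 in \<open>w\<^sup>-\<^sup>1\<close> of the Riccati equation
  determine successively the derivatives of \<open>\<mu>\<close>, \<open>\<mu>\<^sub>0\<close> and \<open>\<mu>\<^sub>1\<close>.
\<close>

unbundle fps_syntax

section \<open>Series with coefficients in a subring\<close>

text \<open>The bound is strict because membership in the subring is proved by induction on the
  degree: what lies below \<open>d\<close> is known, and the coefficient at \<open>d\<close> is the
  unknown.\<close>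

definition coeffs_below :: "'a set \<Rightarrow> nat \<Rightarrow> 'a fps \<Rightarrow> bool" where
  "coeffs_below S d f \<longleftrightarrow> (\<forall>e<d. f $ e \<in> S)"

text \<open>A subring, used for the power series in w^-1 among the Laurent series and for the
  integers among the rationals.\<close>

locale coefficient_ring =
  fixes S :: "'a::comm_ring_1 set"
  assumes one_closed: "1 \<in> S"
    and diff_closed: "a \<in> S \<Longrightarrow> b \<in> S \<Longrightarrow> a - b \<in> S"
    and mult_closed: "a \<in> S \<Longrightarrow> b \<in> S \<Longrightarrow> a * b \<in> S"
begin

lemma zero_closed: "0 \<in> S"
  using diff_closed[OF one_closed one_closed] by simp

lemma add_closed: "a \<in> S \<Longrightarrow> b \<in> S \<Longrightarrow> a + b \<in> S"
  using diff_closed[of a "0 - b"] diff_closed[of 0 b] zero_closed by simp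

lemma sum_closed: "(\<And>i. i \<in> A \<Longrightarrow> f i \<in> S) \<Longrightarrow> sum f A \<in> S"
  by (induction A rule: infinite_finite_induct) (auto simp: zero_closed intro: add_closed)

lemma of_nat_closed: "of_nat k \<in> S"
  by (induction k) (auto simp: zero_closed intro: add_closed one_closed)

lemma power_closed: "a \<in> S \<Longrightarrow> a ^ k \<in> S"
  by (induction k) (auto intro: one_closed mult_closed)

lemma coeffs_below_one: "coeffs_below S d 1"
  by (auto simp: coeffs_below_def zero_closed one_closed)

lemma coeffs_below_const: "a \<in> S \<Longrightarrow> coeffs_below S d (fps_const a)"
  by (auto simp: coeffs_below_def zero_closed)

lemma coeffs_below_add:
  "coeffs_below S d f \<Longrightarrow> coeffs_below S d g \<Longrightarrow> coeffs_below S d (f + g)"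
  by (auto simp: coeffs_below_def intro: add_closed)

lemma coeffs_below_XD: "coeffs_below S d f \<Longrightarrow> coeffs_below S d (fps_XD f)"
  by (auto simp: coeffs_below_def intro: mult_closed of_nat_closed)

lemma coeffs_below_mult:
  "coeffs_below S d f \<Longrightarrow> coeffs_below S d g \<Longrightarrow> coeffs_below S d (f * g)"
  by (auto simp: coeffs_below_def fps_mult_nth intro!: sum_closed mult_closed)

lemma coeffs_below_power: "coeffs_below S d f \<Longrightarrow> coeffs_below S d (f ^ k)"
  by (induction k) (auto intro: coeffs_below_one coeffs_below_mult)

text \<open>Only the two extreme terms of the convolution contain coefficients of index
  \<open>d\<close>. Modulo \<open>S\<close> a product is therefore linear in the unknown top
  coefficients.\<close>

lemma mult_nth_mod:
  assumes f: "coeffs_below S d f" and g: "coeffs_below S d g" and d: "d > 0"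
  shows "(f * g) $ d - (f $ 0 * g $ d + f $ d * g $ 0) \<in> S"
proof -
  have "{0..d} = insert 0 (insert d {1..<d})"
    using d by auto
  then have "(f * g) $ d = f $ 0 * g $ d + (f $ d * g $ 0 + (\<Sum>i = 1..<d. f $ i * g $ (d - i)))"
    using d by (simp add: fps_mult_nth)
  moreover have "(\<Sum>i = 1..<d. f $ i * g $ (d - i)) \<in> S"
    using f g by (auto simp: coeffs_below_def intro!: sum_closed mult_closed)
  ultimately show ?thesis
    by (simp add: algebra_simps)
qed

end

section \<open>The operator x d/dx, exponentials and logarithms\<close>

lemma fps_XD_mult: "fps_XD (f * g) = fps_XD f * g + f * fps_XD (g :: 'a::comm_ring_1 fps)"
  by (simp add: fps_XD_def algebra_simps)

lemma fps_XD_diff: "fps_XD (f - g) = fps_XD f - fps_XD (g :: 'a::comm_ring_1 fps)"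
  by (simp add: fps_XD_def algebra_simps)

lemma fps_XD_const: "fps_XD (fps_const c :: 'a::comm_ring_1 fps) = 0"
  by (simp add: fps_XD_def)

lemma fps_XD_one: "fps_XD (1 :: 'a::comm_ring_1 fps) = 0"
  by (simp add: fps_XD_def)

lemma fps_XD_power:
  fixes f g :: "'a::comm_ring_1 fps"
  assumes "fps_XD f = g * f"
  shows "fps_XD (f ^ k) = of_nat k * g * f ^ k"
  by (induction k) (simp_all add: fps_XD_one fps_XD_mult assms algebra_simps)

text \<open>For u = f - g the equation reads d u_d = sum of h_i u_(d-i). As h_0 = 0, only lower
  coefficients of u enter on the right, and they vanish by induction; d can be cancelled for d >
  0.\<close>

lemma fps_XD_linear_ODE_unique:
  fixes f g h k :: "'a::{idom,ring_char_0} fps"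
  assumes f: "fps_XD f = h * f + k" and g: "fps_XD g = h * g + k"
    and h: "h $ 0 = 0" and init: "f $ 0 = g $ 0"
  shows "f = g"
proof -
  have D: "fps_XD (f - g) = h * (f - g)"
    using f g by (simp add: fps_XD_diff algebra_simps)
  have "(f - g) $ d = 0" for d
  proof (induction d rule: less_induct)
    case (less d)
    show ?case
    proof (cases "d = 0")
      case False
      have "h $ i * (f - g) $ (d - i) = 0" if "i \<in> {0..d}" for i
        using h less[of "d - i"] False that by (cases "i = 0") (auto simp del: fps_sub_nth)
      then have "(h * (f - g)) $ d = 0"
        unfolding fps_mult_nth by (rule sum.neutral[OF ballI])
      then show ?thesis
        using arg_cong[OF D, of "\<lambda>u. u $ d"] False by simp
    qed (simp add: init)
  qed
  then show ?thesis
    by (simp add: fps_eq_iff)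
qed

lemma fps_XD_exp_compose:
  assumes "f $ 0 = 0"
  shows "fps_XD (fps_exp 1 oo f) = fps_XD f * (fps_exp 1 oo (f :: 'a::field_char_0 fps))"
  using fps_compose_deriv[OF assms, of "fps_exp 1"] by (simp add: fps_XD_def algebra_simps)

text \<open>Recognizes an exponential by its logarithmic derivative. This yields both the functional
  equation of exp and exp (log F) = F.\<close>

lemma fps_exp_compose_unique:
  fixes f g :: "'a::field_char_0 fps"
  assumes "f $ 0 = 0" "fps_XD g = fps_XD f * g" "g $ 0 = 1"
  shows "fps_exp 1 oo f = g"
  by (rule fps_XD_linear_ODE_unique[where h = "fps_XD f" and k = 0])
    (use assms in \<open>simp_all add: fps_XD_exp_compose\<close>)

lemma fps_exp_compose_add:
  fixes f g :: "'a::field_char_0 fps"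
  assumes "f $ 0 = 0" "g $ 0 = 0"
  shows "fps_exp 1 oo (f + g) = (fps_exp 1 oo f) * (fps_exp 1 oo g)"
  by (rule fps_exp_compose_unique)
    (use assms in \<open>simp_all add: fps_XD_mult fps_XD_exp_compose algebra_simps\<close>)

lemma fps_XD_ln_compose:
  fixes f :: "'a::field_char_0 fps"
  assumes "f $ 0 = 1"
  shows "fps_XD (fps_ln 1 oo (f - 1)) * f = fps_XD f"
proof -
  have 0: "(f - 1) $ 0 = 0"
    using assms by simp
  have "(inverse (1 + fps_X) oo (f - 1)) * ((1 + fps_X) oo (f - 1)) = 
      (inverse (1 + fps_X) * (1 + fps_X)) oo (f - 1)"
    by (rule fps_compose_mult_distrib[OF 0, symmetric])
  also have "\<dots> = 1"
    by (simp add: inverse_mult_eq_1)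
  finally have "(inverse (1 + fps_X) oo (f - 1)) * f = 1"
    using 0 by (simp add: fps_compose_add_distrib)
  then show ?thesis
    using fps_compose_deriv[OF 0, of "fps_ln 1"]
    by (simp add: fps_XD_def fps_ln_deriv mult.assoc mult.left_commute)
qed

section \<open>The expansion at infinity\<close>

lemma poly_at_infinity_add: "poly_at_infinity (p + q) = poly_at_infinity p + poly_at_infinity q"
proof -
  have "map_poly fls_const (p + q) = map_poly fls_const p + (map_poly fls_const q :: rat fls poly)"
    by (rule poly_eqI) (simp add: coeff_map_poly fls_plus_const)
  then show ?thesis
    by (simp add: poly_at_infinity_def)
qed

lemma poly_at_infinity_1: "poly_at_infinity 1 = 1"
  by (simp add: poly_at_infinity_def)

lemma expand_at_infinity_to_fract: "expand_at_infinity (to_fract p) = poly_at_infinity p"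
  by (simp add: to_fract_def expand_at_infinity_Fract poly_at_infinity_1)

lemma expand_at_infinity_add:
  "expand_at_infinity (f + g) = expand_at_infinity f + expand_at_infinity g"
  by (cases f; cases g)
    (simp add: expand_at_infinity_Fract poly_at_infinity_add poly_at_infinity_mult
      poly_at_infinity_eq_0_iff field_simps)

lemma expand_at_infinity_mult:
  "expand_at_infinity (f * g) = expand_at_infinity f * expand_at_infinity g"
  by (cases f; cases g)
    (simp add: expand_at_infinity_Fract poly_at_infinity_mult)

lemma expand_at_infinity_0 [simp]: "expand_at_infinity 0 = 0"
  using expand_at_infinity_to_fract[of 0] by (simp add: poly_at_infinity_def)

lemma expand_at_infinity_1 [simp]: "expand_at_infinity 1 = 1"
  using expand_at_infinity_to_fract[of 1] by (simp add: poly_at_infinity_1)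

lemma expand_at_infinity_diff:
  "expand_at_infinity (f - g) = expand_at_infinity f - expand_at_infinity g"
  using expand_at_infinity_add[of "f - g" g] by simp

lemma expand_at_infinity_of_nat [simp]: "expand_at_infinity (of_nat k) = of_nat k"
  by (induction k) (simp_all add: expand_at_infinity_add)

lemma expand_at_infinity_power: "expand_at_infinity (f ^ k) = expand_at_infinity f ^ k"
  by (induction k) (simp_all add: expand_at_infinity_mult)

lemma expand_at_infinity_sum: "expand_at_infinity (sum f A) = (\<Sum>i\<in>A. expand_at_infinity (f i))"
  by (induction A rule: infinite_finite_induct) (simp_all add: expand_at_infinity_add)

lemma expand_at_infinity_prod: "expand_at_infinity (prod f A) = (\<Prod>i\<in>A. expand_at_infinity (f i))"
  by (induction A rule: infinite_finite_induct) (simp_all add: expand_at_infinity_mult)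

lemma expand_at_infinity_ratw: "expand_at_infinity ratw = fls_X_inv"
  by (simp add: ratw_def expand_at_infinity_to_fract poly_at_infinity_def map_poly_pCons)

text \<open>Multiplicative and compatible with \<open>fps_XD\<close>, so it carries identities over
  Q(w) to identities over Laurent series in w^-1.\<close>

definition expand_coeffs :: "rat poly fract fps \<Rightarrow> rat fls fps" where
  "expand_coeffs f = Abs_fps (\<lambda>d. expand_at_infinity (f $ d))"

lemma expand_coeffs_nth: "expand_coeffs f $ d = expand_at_infinity (f $ d)"
  by (simp add: expand_coeffs_def)

lemma expand_coeffs_mult: "expand_coeffs (f * g) = expand_coeffs f * expand_coeffs g"
  by (simp add: fps_eq_iff expand_coeffs_nth fps_mult_nth expand_at_infinity_sum
      expand_at_infinity_mult)

lemma expand_coeffs_XD: "expand_coeffs (fps_XD f) = fps_XD (expand_coeffs f)"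
  by (simp add: fps_eq_iff expand_coeffs_nth expand_at_infinity_mult)

text \<open>At w = 0 the two polynomials take the values r^n and 0. Hence no denominator in
  \<open>calF\<close> vanishes.\<close>

lemma ratw_shift_power_neq:
  assumes "n > 0" "r > 0"
  shows "(ratw + of_nat r) ^ n \<noteq> ratw ^ n"
proof
  have pow: "to_fract (p ^ k) = to_fract p ^ k" for p :: "rat poly" and k
    by (induction k) simp_all
  have "of_nat r = to_fract [:of_nat r :: rat:]" 
    by (simp add: to_fract_def Fract_of_nat_eq flip: of_nat_poly)
  then have "ratw + of_nat r = to_fract [:of_nat r, 1:]"
    by (simp add: ratw_def flip: to_fract_add)
  moreover assume "(ratw + of_nat r) ^ n = ratw ^ n"
  ultimately have "[:of_nat r, 1:] ^ n = [:0, 1 :: rat:] ^ n"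
    by (simp add: ratw_def flip: pow)
  then have "poly ([:of_nat r, 1:] ^ n) 0 = poly ([:0, 1 :: rat:] ^ n) 0"
    by simp
  then show False
    using assms by (simp add: power_0_left)
qed

lemma calF_nth_0: "calF n $ 0 = 1"
  by (simp add: calF_def)

text \<open>This is the differential equation for F read off coefficientwise, since D_w = w + x d/dx
  multiplies x^d by w + d.\<close>

lemma calF_nth_Suc:
  assumes "n > 0"
  shows "((ratw + of_nat (Suc d)) ^ n - ratw ^ n) * calF n $ Suc d =
    (\<Prod>j = 1..n. of_nat n * (ratw + of_nat d) + of_nat j) * calF n $ d"
proof -
  have "(\<Prod>r = 1..n * Suc d. of_nat n * ratw + of_nat r) =
      (\<Prod>r = 1..n * d. of_nat n * ratw + of_nat r) *
      (\<Prod>r = 1 + n * d..n + n * d. of_nat n * ratw + of_nat r)"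
    using prod.ub_add_nat[of 1 "n * d" "\<lambda>r. of_nat n * ratw + of_nat r" n]
    by (simp add: add_ac)
  also have "(\<Prod>r = 1 + n * d..n + n * d. of_nat n * ratw + of_nat r) =
      (\<Prod>j = 1..n. of_nat n * ratw + of_nat (j + n * d))"
    by (rule prod.shift_bounds_cl_nat_ivl)
  also have "\<dots> = (\<Prod>j = 1..n. of_nat n * (ratw + of_nat d) + of_nat j)"
    by (intro prod.cong) (simp_all add: algebra_simps)
  finally have num: "(\<Prod>r = 1..n * Suc d. of_nat n * ratw + of_nat r) =
      (\<Prod>r = 1..n * d. of_nat n * ratw + of_nat r) *
      (\<Prod>j = 1..n. of_nat n * (ratw + of_nat d) + of_nat j)" .
  have den: "(\<Prod>r = 1..Suc d. (ratw + of_nat r) ^ n - ratw ^ n) =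
      (\<Prod>r = 1..d. (ratw + of_nat r) ^ n - ratw ^ n) * ((ratw + of_nat (Suc d)) ^ n - ratw ^ n)"
    by simp
  have "(ratw + of_nat (Suc d)) ^ n - ratw ^ n \<noteq> 0"
    using ratw_shift_power_neq[OF assms, of "Suc d"] by simp
  then show ?thesis
    unfolding calF_def fps_nth_Abs_fps num den by simp
qed

section \<open>The Riccati equation\<close>

lemma expand_log_calF:
  fixes n :: nat
  defines "E \<equiv> expand_coeffs (log_calF n)" and "G \<equiv> expand_coeffs (calF n)"
  shows "fps_XD G = fps_XD E * G" and "E $ 0 = 0" and "G $ 0 = 1"
proof -
  have "fps_XD (log_calF n) * calF n = fps_XD (calF n)"
    unfolding log_calF_def by (rule fps_XD_ln_compose) (simp add: calF_nth_0)
  then show "fps_XD G = fps_XD E * G"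
    unfolding E_def G_def by (metis expand_coeffs_XD expand_coeffs_mult)
  show "E $ 0 = 0" "G $ 0 = 1"
    by (simp_all add: E_def G_def expand_coeffs_nth log_calF_def calF_nth_0)
qed

text \<open>
  With \<open>Y = 1 + w\<^sup>-\<^sup>1 x d/dx log F\<close> and \<open>D\<^sub>w = w + x d/dx\<close>, the series \<open>riccati c Y k\<close> is
  \<open>w\<^sup>-\<^sup>k F\<^sup>-\<^sup>1 (D\<^sub>w + c) (D\<^sub>w + 2 c) \<dots> (D\<^sub>w + k c) F\<close>, see \<open>riccati_times\<close>.
\<close>

primrec riccati :: "rat \<Rightarrow> rat fls fps \<Rightarrow> nat \<Rightarrow> rat fls fps" where
  "riccati c Y 0 = 1"
| "riccati c Y (Suc k) =
    (Y + fps_const (fls_const (c * of_nat (Suc k)) * fls_X)) * riccati c Y k +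
    fps_const fls_X * fps_XD (riccati c Y k)"

lemma fls_X_inv_times_X: "fls_X_inv * fls_X = (1 :: rat fls)"
  by (simp add: fls_X_inv_times_conv_shift)

text \<open>Since D_w acts on x^d as w + d, the right side is (D_w + c) ... (D_w + k c) G. In the
  induction step the product rule applied to w^k R G reproduces the recursion of
  \<open>riccati\<close>.\<close>

lemma riccati_times:
  assumes G: "fps_XD G = fps_XD E * G" and Y: "Y = 1 + fps_const fls_X * fps_XD E"
  shows "fps_const (fls_X_inv ^ k) * riccati c Y k * G =
    Abs_fps (\<lambda>d. (\<Prod>j = 1..k. fls_X_inv + of_nat d + fls_const (c * of_nat j)) * G $ d)"
proof (induction k)
  case 0
  show ?case
    by (simp add: fps_eq_iff)
next
  case (Suc k)
  define R where "R = riccati c Y k"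
  define H where "H = fps_const (fls_X_inv ^ k) * R * G"
  define a :: "rat fls" where "a = fls_const (c * of_nat (Suc k))"
  have wt: "fps_const fls_X_inv * fps_const fls_X = (1 :: rat fls fps)"
    by (simp add: fls_X_inv_times_X)
  have XDH: "fps_XD H = fps_const (fls_X_inv ^ k) * (fps_XD R + R * fps_XD E) * G"
    unfolding H_def by (simp add: fps_XD_mult fps_XD_const G algebra_simps)
  have "fps_const (fls_X_inv ^ Suc k) * riccati c Y (Suc k) * G =
      fps_const (fls_X_inv ^ k) * fps_const fls_X_inv *
        ((1 + fps_const fls_X * fps_XD E + fps_const a * fps_const fls_X) * R
          + fps_const fls_X * fps_XD R) * G"
    by (simp add: R_def a_def Y mult.commute[of fls_X_inv])
  also have "\<dots> = fps_const (fls_X_inv ^ k) * (fps_const fls_X_inv * R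
      + (fps_const fls_X_inv * fps_const fls_X) * (R * fps_XD E + fps_const a * R + fps_XD R)) * G"
    by (simp only: algebra_simps mult_1_left)
  \<comment> \<open>\<open>fps_XDp a\<close> is the operator a + x d/dx, here D_w + c (k +
    1).\<close>
  also have "\<dots> = fps_XDp (fls_X_inv + a) H"
    unfolding wt fps_XDp_def XDH by (simp add: H_def algebra_simps flip: fps_const_add)
  also have "\<dots> = Abs_fps (\<lambda>d.
      (\<Prod>j = 1..Suc k. fls_X_inv + of_nat d + fls_const (c * of_nat j)) * G $ d)"
    unfolding H_def R_def Suc.IH by (simp add: fps_eq_iff a_def algebra_simps)
  finally show ?case .
qed

lemma riccati_equation:
  fixes n :: nat
  assumes n: "n > 0"
  defines "Y \<equiv> 1 + fps_const fls_X * fps_XD (expand_coeffs (log_calF n))"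
  shows "riccati 0 Y n - 1 = fps_const (of_nat n ^ n) * fps_X * riccati (1 / of_nat n) Y n"
proof -
  define E where "E = expand_coeffs (log_calF n)"
  define G where "G = expand_coeffs (calF n)"
  note EG = expand_log_calF[of n, folded E_def G_def]
  have ric: "fps_const (fls_X_inv ^ n) * riccati c Y n * G =
      Abs_fps (\<lambda>d. (\<Prod>j = 1..n. fls_X_inv + of_nat d + fls_const (c * of_nat j)) * G $ d)" for c
    by (rule riccati_times) (simp_all add: EG Y_def E_def)
  have G_Suc: "((fls_X_inv + of_nat (Suc d)) ^ n - fls_X_inv ^ n) * G $ Suc d =
      (\<Prod>j = 1..n. of_nat n * (fls_X_inv + of_nat d) + of_nat j) * G $ d" for d
    using arg_cong[OF calF_nth_Suc[OF n, of d], of expand_at_infinity]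
    by (simp add: G_def expand_coeffs_nth expand_at_infinity_mult expand_at_infinity_prod
        expand_at_infinity_add expand_at_infinity_diff expand_at_infinity_power
        expand_at_infinity_ratw del: of_nat_Suc)
  \<comment> \<open>Taking n out of each of the n factors leaves steps of size 1/n, which is the
    parameter \<open>c\<close> on the right side of the equation.\<close>
  have shift: "(\<Prod>j = 1..n. of_nat n * (fls_X_inv + of_nat d) + of_nat j) =
      of_nat n ^ n *
        (\<Prod>j = 1..n. fls_X_inv + of_nat d + fls_const (1 / of_nat n * of_nat j) :: rat fls)"
    for d :: nat
  proof -
    have "of_nat n * fls_const (1 / of_nat n * of_nat j) = (of_nat j :: rat fls)" for j :: nat
      using n by (simp add: fls_of_nat fls_const_mult_const)
    then have "of_nat n * (fls_X_inv + of_nat d) + (of_nat j :: rat fls) =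
        of_nat n * (fls_X_inv + of_nat d + fls_const (1 / of_nat n * of_nat j))" for j :: nat
      by (simp only: distrib_left)
    then have "(\<Prod>j = 1..n. of_nat n * (fls_X_inv + of_nat d) + of_nat j :: rat fls) =
        (\<Prod>j = 1..n. of_nat n * (fls_X_inv + of_nat d + fls_const (1 / of_nat n * of_nat j)))"
      by (simp only:)
    also have "\<dots> = (\<Prod>j = 1..n. of_nat n) *
        (\<Prod>j = 1..n. fls_X_inv + of_nat d + fls_const (1 / of_nat n * of_nat j))"
      by (rule prod.distrib)
    finally show ?thesis
      by simp
  qed
  have "fps_const (fls_X_inv ^ n) * (riccati 0 Y n - 1) * G =
      fps_const (fls_X_inv ^ n) * riccati 0 Y n * G - fps_const (fls_X_inv ^ n) * G"
    by (simp add: algebra_simps)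
  also have "\<dots> = fps_const (of_nat n ^ n) * fps_X *
      (fps_const (fls_X_inv ^ n) * riccati (1 / of_nat n) Y n * G)"
  proof (rule fps_ext)
    fix d
    show "(fps_const (fls_X_inv ^ n) * riccati 0 Y n * G - fps_const (fls_X_inv ^ n) * G) $ d =
      (fps_const (of_nat n ^ n) * fps_X *
        (fps_const (fls_X_inv ^ n) * riccati (1 / of_nat n) Y n * G)) $ d"
      \<comment> \<open>The factor x shifts the index by one. For d = 0 both sides vanish, the left
        one because its product is w^n.\<close>
      unfolding ric using G_Suc[of "d - 1"] shift[of "d - 1"]
      by (cases d) (simp_all add: mult.assoc left_diff_distrib del: of_nat_Suc)
  qed
  also have "\<dots> = fps_const (fls_X_inv ^ n) *
      (fps_const (of_nat n ^ n) * fps_X * riccati (1 / of_nat n) Y n) * G"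
    by (simp only: mult_ac)
  finally show ?thesis
    using EG(3) by (auto simp del: fps_const_power)
qed

section \<open>Regularity at infinity: Laurent series without positive powers of w\<close>

abbreviation regular :: "rat fls set" where
  "regular \<equiv> range fps_to_fls"

interpretation regular: coefficient_ring regular
proof
  show "1 \<in> regular"
    by (metis fps_one_to_fls rangeI)
  show "a - b \<in> regular" if "a \<in> regular" "b \<in> regular" for a b
    using that by (metis (no_types, lifting) fps_to_fls_minus imageE rangeI)
  show "a * b \<in> regular" if "a \<in> regular" "b \<in> regular" for a b
    using that by (metis (no_types, lifting) fls_times_fps_to_fls imageE rangeI)
qed

lemma fls_X_regular: "fls_X \<in> regular"
  by (metis fps_X_to_fls rangeI)

lemma fls_const_regular: "fls_const a \<in> regular"
  by (metis fps_const_to_fls rangeI)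

lemma riccati_coeffs_below:
  assumes "coeffs_below regular d Y"
  shows "coeffs_below regular d (riccati c Y k)"
  by (induction k)
    (auto intro!: assms regular.coeffs_below_one regular.coeffs_below_add regular.coeffs_below_mult
      regular.coeffs_below_const regular.coeffs_below_XD regular.mult_closed
      fls_X_regular fls_const_regular)

lemma riccati_0_nth_0: "Y $ 0 = 1 \<Longrightarrow> riccati 0 Y k $ 0 = 1"
  by (induction k) simp_all

text \<open>With u = 1 + d/w, one step of the recursion sends the coefficient R_d to u R_d + Y_d
  modulo regular series; iteration produces the geometric sum. The value c = 0 belongs to the side
  of the equation without the factor x.\<close>

lemma riccati_0_nth_mod:
  assumes Y: "coeffs_below regular d Y" and Y0: "Y $ 0 = 1" and d: "d > 0"
  shows "riccati 0 Y k $ d - (\<Sum>i<k. (1 + of_nat d * fls_X) ^ i) * Y $ d \<in> regular"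
proof (induction k)
  case 0
  then show ?case
    using d by (simp add: regular.zero_closed)
next
  case (Suc k)
  define R u where "R = riccati 0 Y k" and "u = (1 + of_nat d * fls_X :: rat fls)"
  have u: "u \<in> regular"
    unfolding u_def by (intro regular.add_closed regular.one_closed regular.mult_closed
        regular.of_nat_closed fls_X_regular)
  have sum: "(\<Sum>i<Suc k. u ^ i) = 1 + u * (\<Sum>i<k. u ^ i)"
    by (simp add: sum.lessThan_Suc_shift sum_distrib_left del: sum.lessThan_Suc)
  have "(Y * R) $ d - (Y $ 0 * R $ d + Y $ d * R $ 0) \<in> regular"
    unfolding R_def by (intro regular.mult_nth_mod Y riccati_coeffs_below d)
  moreover have "u * (R $ d - (\<Sum>i<k. u ^ i) * Y $ d) \<in> regular"
    using Suc.IH u by (auto simp: R_def u_def intro: regular.mult_closed)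
  ultimately have "(Y * R) $ d - (Y $ 0 * R $ d + Y $ d * R $ 0) +
      u * (R $ d - (\<Sum>i<k. u ^ i) * Y $ d) \<in> regular"
    by (rule regular.add_closed)
  also have "(Y * R) $ d - (Y $ 0 * R $ d + Y $ d * R $ 0) +
      u * (R $ d - (\<Sum>i<k. u ^ i) * Y $ d) =
      riccati 0 Y (Suc k) $ d - (\<Sum>i<Suc k. u ^ i) * Y $ d"
    unfolding sum using Y0 riccati_0_nth_0[OF Y0, of k]
    by (simp add: R_def[symmetric]) (simp add: u_def algebra_simps)
  finally show ?case
    by (simp only: u_def)
qed

lemma riccati_solution_regular:
  fixes n :: nat
  assumes n: "n > 0" and Y0: "Y $ 0 = 1"
    and eq: "riccati 0 Y n - 1 = fps_const (of_nat n ^ n) * fps_X * riccati c Y n"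
  shows "Y $ d \<in> regular"
proof (induction d rule: less_induct)
  case (less d)
  show ?case
  proof (cases "d = 0")
    case True
    then show ?thesis
      by (simp add: Y0 regular.one_closed)
  next
    case False
    then have d: "d > 0"
      by simp
    have Y: "coeffs_below regular d Y"
      using less by (simp add: coeffs_below_def)
    \<comment> \<open>Built as a power series in w^-1 so that its inverse is again one: its constant
      term n is nonzero.\<close>
    define U :: "rat fps" where "U = (\<Sum>i<n. (1 + of_nat d * fps_X) ^ i)"
    have U: "fps_to_fls U = (\<Sum>i<n. (1 + of_nat d * fls_X) ^ i)"
    proof -
      have "fps_to_fls (\<Sum>i<k. (1 + of_nat d * fps_X) ^ i) =
          (\<Sum>i<k. (1 + of_nat d * fls_X :: rat fls) ^ i)" for k
        by (induction k) (simp_all add: fps_to_fls_power fls_times_fps_to_fls)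
      then show ?thesis
        unfolding U_def .
    qed
    have "U $ 0 = of_nat n"
      unfolding U_def by (simp add: fps_sum_nth fps_power_zeroth)
    then have "inverse U * U = 1"
      using n by (simp add: inverse_mult_eq_1)
    then have inv: "fps_to_fls (inverse U) * fps_to_fls U = 1"
      by (metis fls_times_fps_to_fls fps_one_to_fls)
    \<comment> \<open>Because of the factor x, the right side involves only coefficients of
      \<open>Y\<close> below \<open>d\<close>, which are regular by induction.\<close>
    have "riccati 0 Y n $ d = of_nat n ^ n * riccati c Y n $ (d - 1)"
      using arg_cong[OF eq, of "\<lambda>f. f $ d"] d by (simp add: mult.assoc)
    also have "\<dots> \<in> regular"
      using riccati_coeffs_below[OF Y, of c n] d
      by (auto simp: coeffs_below_def
          intro!: regular.mult_closed regular.power_closed regular.of_nat_closed)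
    finally have "riccati 0 Y n $ d - (riccati 0 Y n $ d - fps_to_fls U * Y $ d) \<in> regular"
      using riccati_0_nth_mod[OF Y Y0 d, of n] unfolding U by (rule regular.diff_closed)
    then have "fps_to_fls U * Y $ d \<in> regular"
      by (simp only: diff_diff_eq2 add_diff_cancel_left')
    then have "fps_to_fls (inverse U) * (fps_to_fls U * Y $ d) \<in> regular"
      by (rule regular.mult_closed[OF rangeI])
    then show ?thesis
      by (simp only: mult.assoc[symmetric] inv mult_1_left)
  qed
qed

section \<open>Extraction of the coefficient of w^-j as a power series in x\<close>

definition wcoeff :: "int \<Rightarrow> rat fls fps \<Rightarrow> rat fps" where
  "wcoeff j f = Abs_fps (\<lambda>d. fls_nth (f $ d) j)"

lemma wcoeff_nth: "wcoeff j f $ d = fls_nth (f $ d) j"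
  by (simp add: wcoeff_def)

lemma wcoeff_add: "wcoeff j (f + g) = wcoeff j f + wcoeff j g"
  by (simp add: fps_eq_iff wcoeff_nth)

lemma wcoeff_diff: "wcoeff j (f - g) = wcoeff j f - wcoeff j g"
  by (simp add: fps_eq_iff wcoeff_nth)

lemma wcoeff_1: "wcoeff j 1 = (if j = 0 then 1 else 0)"
  by (simp add: fps_eq_iff wcoeff_nth)

lemma wcoeff_XD: "wcoeff j (fps_XD f) = fps_XD (wcoeff j f)"
  by (simp add: fps_eq_iff wcoeff_nth)

lemma wcoeff_X_times: "wcoeff j (fps_X * f) = fps_X * wcoeff j f"
  by (simp add: fps_eq_iff wcoeff_nth)

lemma wcoeff_const_times: "wcoeff j (fps_const (fls_const a) * f) = fps_const a * wcoeff j f"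
  by (simp add: fps_eq_iff wcoeff_nth)

lemma wcoeff_winv_times: "wcoeff j (fps_const fls_X * f) = wcoeff (j - 1) f"
  by (simp add: fps_eq_iff wcoeff_nth fls_X_times_conv_shift)

definition regular_series :: "rat fls fps \<Rightarrow> bool" where
  "regular_series f \<longleftrightarrow> (\<forall>d. f $ d \<in> regular)"

lemma regular_series_iff: "regular_series f \<longleftrightarrow> (\<forall>d. coeffs_below regular d f)"
  unfolding regular_series_def coeffs_below_def by blast

lemma wcoeff_regular_neg: "regular_series f \<Longrightarrow> wcoeff (-1) f = 0"
  by (auto simp: fps_eq_iff wcoeff_nth regular_series_def image_iff)
    (metis fps_to_fls_nth neg_less_0_iff_less zero_less_one)

text \<open>Without positive powers of w the convolution in w^-1 is finite; it is interchanged with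
  the convolution in x.\<close>

lemma wcoeff_mult:
  assumes "regular_series f" "regular_series g"
  shows "wcoeff (int s) (f * g) = (\<Sum>i = 0..s. wcoeff (int i) f * wcoeff (int (s - i)) g)"
proof (rule fps_ext)
  fix d
  obtain a where a: "f $ i = fps_to_fls (a i)" for i
    using assms(1) unfolding regular_series_def image_iff by metis
  obtain b where b: "g $ i = fps_to_fls (b i)" for i
    using assms(2) unfolding regular_series_def image_iff by metis
  have "wcoeff (int s) (f * g) $ d =
      (\<Sum>j = 0..d. \<Sum>i = 0..s. a j $ i * b (d - j) $ (s - i))"
    by (simp add: wcoeff_nth fps_mult_nth fls_nth_sum a b fls_times_fps_to_fls[symmetric])
  also have "\<dots> = (\<Sum>i = 0..s. \<Sum>j = 0..d. a j $ i * b (d - j) $ (s - i))"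
    by (rule sum.swap)
  also have "\<dots> = (\<Sum>i = 0..s. wcoeff (int i) f * wcoeff (int (s - i)) g) $ d"
    by (simp add: fps_sum_nth fps_mult_nth wcoeff_nth a b del: of_nat_diff)
  finally show "wcoeff (int s) (f * g) $ d = \<dots>" .
qed

lemma wcoeff_mult_012:
  assumes "regular_series f" "regular_series g"
  shows "wcoeff 0 (f * g) = wcoeff 0 f * wcoeff 0 g"
    and "wcoeff 1 (f * g) = wcoeff 0 f * wcoeff 1 g + wcoeff 1 f * wcoeff 0 g"
    and "wcoeff 2 (f * g) =
      wcoeff 0 f * wcoeff 2 g + wcoeff 1 f * wcoeff 1 g + wcoeff 2 f * wcoeff 0 g"
  using wcoeff_mult[OF assms, of 0] wcoeff_mult[OF assms, of 1] wcoeff_mult[OF assms, of 2]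
  by (simp_all add: numeral_2_eq_2)

lemma regular_series_XD: "regular_series f \<Longrightarrow> regular_series (fps_XD f)"
  by (simp add: regular_series_iff regular.coeffs_below_XD)

lemma regular_series_riccati: "regular_series Y \<Longrightarrow> regular_series (riccati c Y k)"
  by (simp add: regular_series_iff riccati_coeffs_below)

text \<open>The terms of the recursion with a factor w^-1 contribute from the preceding order; at
  order 0 they drop out by regularity.\<close>

lemma wcoeff_riccati:
  fixes c :: rat
  assumes Y: "regular_series Y"
  defines "R \<equiv> \<lambda>j k. wcoeff j (riccati c Y k)"
  shows "R 0 (Suc k) = wcoeff 0 Y * R 0 k"
    and "R 1 (Suc k) = wcoeff 0 Y * R 1 k + wcoeff 1 Y * R 0 k +
      fps_const c * of_nat (Suc k) * R 0 k + fps_XD (R 0 k)"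
    and "R 2 (Suc k) = wcoeff 0 Y * R 2 k + wcoeff 1 Y * R 1 k + wcoeff 2 Y * R 0 k +
      fps_const c * of_nat (Suc k) * R 1 k + fps_XD (R 1 k)"
proof -
  have R: "regular_series (riccati c Y k)"
    by (rule regular_series_riccati[OF Y])
  have step: "riccati c Y (Suc k) = Y * riccati c Y k +
      fps_const fls_X * (fps_const (fls_const (c * of_nat (Suc k))) * riccati c Y k) +
      fps_const fls_X * fps_XD (riccati c Y k)"
    by (simp add: distrib_right flip: fps_const_mult)
  have c: "fps_const (c * of_nat (Suc k)) = fps_const c * of_nat (Suc k)"
    by (simp only: fps_of_nat[symmetric] fps_const_mult)
  show "R 0 (Suc k) = wcoeff 0 Y * R 0 k"
    "R 1 (Suc k) = wcoeff 0 Y * R 1 k + wcoeff 1 Y * R 0 k +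
      fps_const c * of_nat (Suc k) * R 0 k + fps_XD (R 0 k)"
    "R 2 (Suc k) = wcoeff 0 Y * R 2 k + wcoeff 1 Y * R 1 k + wcoeff 2 Y * R 0 k +
      fps_const c * of_nat (Suc k) * R 1 k + fps_XD (R 1 k)"
    unfolding R_def step
    by (simp_all only: wcoeff_add wcoeff_winv_times wcoeff_const_times wcoeff_XD
        wcoeff_mult_012[OF Y R] c)
      (simp_all add: wcoeff_regular_neg R fps_XD_def)
qed

section \<open>The first three orders\<close>

text \<open>\<open>A k\<close> is the order 1 part of \<open>riccati c Y k\<close>. As x d/dx sends
  L^k to k l L^k, the recursion sums the arithmetic progressions 0, ..., k-1 and 1, ..., k; the
  factor 2 L clears denominators.\<close>

lemma WKB_order_1:
  fixes L Y1 c l :: "'a::idom fps" and A :: "nat \<Rightarrow> 'a fps" and k :: nat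
  assumes L: "fps_XD L = l * L"
    and A0: "A 0 = 0"
    and A_Suc: "\<And>k. A (Suc k) = L * A k + Y1 * L ^ k + c * of_nat (Suc k) * L ^ k + fps_XD (L ^ k)"
  shows "2 * L * A k =
    L ^ k * (2 * of_nat k * Y1 + of_nat k * (of_nat k - 1) * l + of_nat k * (of_nat k + 1) * c)"
proof (induction k)
  case 0
  then show ?case by (simp add: A0)
next
  case (Suc k)
  have "2 * L * A (Suc k) = L * (2 * L * A k) + 2 * L ^ Suc k * (Y1 + c * of_nat (Suc k)
      + of_nat k * l)"
    by (simp add: A_Suc fps_XD_power[OF L] algebra_simps)
  then show ?case
    unfolding Suc.IH by (simp add: algebra_simps)
qed

text \<open>\<open>B k\<close> is the order 2 part, and the hypothesis on \<open>A\<close> is the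
  order 1 formula with Y1 = l. In the application \<open>M\<close> is L^n.\<close>

lemma WKB_order_2:
  fixes L Y2 c l M :: "'a::idom fps" and A B :: "nat \<Rightarrow> 'a fps" and k :: nat
  assumes L: "fps_XD L = l * L" and l: "fps_XD l = l * M" and c: "fps_XD c = 0" 
    and A: "\<And>k. 2 * L * A k = L ^ k * (of_nat k * (of_nat k + 1) * (l + c))"
    and B0: "B 0 = 0"
    and B_Suc: "\<And>k. B (Suc k) = L * B k + l * A k + Y2 * L ^ k + c * of_nat (Suc k) * A k +
      fps_XD (A k)"
  shows "24 * L^2 * B k = L ^ k * (24 * of_nat k * Y2 * L +
    (of_nat k - 1) * of_nat k * (of_nat k + 1) *
      ((3 * of_nat k - 2) * l * (l + c) + 4 * l * M + (3 * of_nat k + 2) * c * (l + c)))"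
proof (induction k)
  case 0
  then show ?case by (simp add: B0)
next
  case (Suc k)
  define K where "K = (of_nat k * (of_nat k + 1) :: 'a fps)"
  have K: "fps_XD K = 0"
    unfolding K_def by (simp add: fps_XD_def)
  have A': "2 * L * A k = L ^ k * (K * (l + c))"
    using A[of k] by (simp add: K_def)
  \<comment> \<open>Differentiating the closed form of 2 L A gives the derivative of
    \<open>A k\<close> without a division by \<open>L\<close>.\<close>
  have "fps_XD (2 * L * A k) = l * (2 * L * A k) + 2 * L * fps_XD (A k)"
    by (simp add: fps_XD_mult L algebra_simps) (simp add: fps_XD_def)
  moreover have "fps_XD (L ^ k * (K * (l + c))) = L ^ k * (of_nat k * l * K * (l + c) + K * (l * M))"
    by (simp add: fps_XD_mult fps_XD_power[OF L] K c l algebra_simps)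
  ultimately have XDA: "2 * L * fps_XD (A k) =
      L ^ k * (of_nat k * l * K * (l + c) + K * (l * M)) - l * (L ^ k * (K * (l + c)))"
    unfolding A' by (simp add: algebra_simps)
  have "24 * L^2 * B (Suc k) = L * (24 * L^2 * B k) + 12 * L * (l + c * of_nat (Suc k)) * (2 * L * A k)
      + 24 * L^2 * Y2 * L ^ k + 12 * L * (2 * L * fps_XD (A k))"
    by (simp add: B_Suc power2_eq_square algebra_simps)
  also have "\<dots> = L * L ^ k * (24 * of_nat (Suc k) * Y2 * L +
    (of_nat (Suc k) - 1) * of_nat (Suc k) * (of_nat (Suc k) + 1) *
      ((3 * of_nat (Suc k) - 2) * l * (l + c) + 4 * l * M + (3 * of_nat (Suc k) + 2) * c * (l + c)))"
    unfolding Suc.IH A' XDA by (simp add: K_def power2_eq_square algebra_simps)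
  finally show ?case
    by simp
qed

section \<open>The series L as an n-th root\<close>

lemma L_series_nth_0: "L_series n $ 0 = 1"
  by (simp add: L_series_def)

lemma L_series_power:
  fixes n :: nat
  assumes "n > 0"
  shows "L_series n ^ n * (1 - fps_const (of_nat n ^ n) * fps_X) = 1"
proof -
  define z where "z = - fps_const (of_nat n ^ n :: rat) * fps_X"
  have z0: "z $ 0 = 0"
    by (simp add: z_def)
  have "L_series n ^ n = fps_binomial (of_nat n * (- 1 / of_nat n)) oo z"
    unfolding L_series_def z_def[symmetric] fps_compose_power[OF z0] fps_binomial_power ..
  also have "of_nat n * (- 1 / of_nat n) = (- 1 :: rat)"
    using assms by simp
  finally have "L_series n ^ n * ((1 + fps_X) oo z) = (inverse (1 + fps_X) * (1 + fps_X)) oo z"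
    by (simp only: fps_binomial_minus_one fps_compose_mult_distrib[OF z0])
  also have "\<dots> = 1"
    by (simp add: inverse_mult_eq_1)
  finally show ?thesis
    using z0 by (simp add: fps_compose_add_distrib z_def del: fps_const_neg)
qed

text \<open>The cofactor of f - g in f^n - g^n has constant term n, so it is nonzero.\<close>

lemma fps_power_eq_imp_eq:
  fixes f g :: "'a::{idom,ring_char_0} fps"
  assumes "f ^ n = g ^ n" "f $ 0 = 1" "g $ 0 = 1" "n > 0"
  shows "f = g"
proof -
  have "(f - g) * (\<Sum>i<n. f ^ i * g ^ (n - Suc i)) = 0"
    using power_diff_sumr2[of f n g] assms(1) by (simp add: mult_ac)
  moreover have "(\<Sum>i<n. f ^ i * g ^ (n - Suc i)) $ 0 = of_nat n"
    using assms by (simp add: fps_sum_nth fps_power_zeroth)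
  then have "(\<Sum>i<n. f ^ i * g ^ (n - Suc i)) \<noteq> 0"
    using assms(4) by (metis fps_zero_nth of_nat_eq_0_iff not_gr_zero)
  ultimately show ?thesis
    by simp
qed

text \<open>Order 0 determines L^n. At orders 1 and 2 the closed forms for c = 0 and c = 1/n are
  compared; L^n Z = n l and L^n = n l + 1 make the comparison linear in the unknown.\<close>

lemma WKB_solution:
  fixes n :: nat
  assumes n: "n > 0" and Y: "regular_series Y" and Y0: "Y $ 0 = 1"
    and eq: "riccati 0 Y n - 1 = fps_const (of_nat n ^ n) * fps_X * riccati (1 / of_nat n) Y n"
  defines "L \<equiv> L_series n"
  defines "l \<equiv> fps_const (1 / of_nat n) * (L ^ n - 1)"
  shows "wcoeff 0 Y = L" and "wcoeff 1 Y = l" and "fps_XD L = l * L"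
    and "24 * of_nat n * wcoeff 2 Y * L =
      - ((of_nat n - 1) * (of_nat n + 1) * (of_nat n - 2) * l * L ^ n)"
proof -
  define Z where "Z = fps_const (of_nat n ^ n) * (fps_X :: rat fps)"
  define A where "A = (\<lambda>c k. wcoeff 1 (riccati c Y k))"
  define B where "B = (\<lambda>c k. wcoeff 2 (riccati c Y k))"
  define C :: "rat fps" where "C = fps_const (1 / of_nat n)"
  define N :: "rat fps" where "N = of_nat n"
  have NC: "N * C = 1"
    using n by (simp add: N_def C_def fps_of_nat[symmetric] fps_const_mult)
  have N_nz: "N \<noteq> 0"
    using NC by auto
  have L0: "L $ 0 = 1"
    by (simp add: L_def L_series_nth_0)
  have L_nz: "L ^ j \<noteq> 0" for j
    using L0 by auto
  have LZ: "L ^ n * (1 - Z) = 1"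
    unfolding L_def Z_def by (rule L_series_power[OF n])
  have ord: "wcoeff j (riccati 0 Y n) - wcoeff j 1 = Z * wcoeff j (riccati (1 / of_nat n) Y n)" for j
  proof -
    have "wcoeff j (riccati 0 Y n - 1) = wcoeff j
        (fps_const (fls_const (of_nat n ^ n)) * (fps_X * riccati (1 / of_nat n) Y n))"
      unfolding eq by (simp add: fls_of_nat fls_const_power mult.assoc)
    then show ?thesis
      unfolding wcoeff_diff wcoeff_const_times wcoeff_X_times Z_def by (simp only: mult.assoc)
  qed
  have R0: "wcoeff 0 (riccati c Y k) = wcoeff 0 Y ^ k" for c k
    by (induction k) (simp_all add: wcoeff_1 wcoeff_riccati(1)[OF Y] del: riccati.simps(2))

  have "wcoeff 0 Y ^ n * (1 - Z) = 1"
    using ord[of 0] by (simp add: R0 wcoeff_1 algebra_simps)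
  then have "wcoeff 0 Y ^ n * (1 - Z) = L ^ n * (1 - Z)" 
    using LZ by simp
  moreover have "1 - Z \<noteq> 0"
    using LZ by auto
  ultimately have "wcoeff 0 Y ^ n = L ^ n"
    by simp
  then show YL: "wcoeff 0 Y = L"
    by (rule fps_power_eq_imp_eq) (use n Y0 in \<open>simp_all add: wcoeff_nth L0\<close>)

  have Nl: "N * l = L ^ n - 1"
    using NC by (simp add: l_def C_def[symmetric] mult.assoc[symmetric])
  then have Ln: "L ^ n = N * l + 1"
    by simp
  have LnZ: "L ^ n * Z = N * l"
    using LZ by (simp add: Nl algebra_simps)
  have XDZ: "fps_XD Z = Z"
    by (simp add: Z_def fps_eq_iff)
  have XDLn: "fps_XD (L ^ n) = N * l * L ^ n"
  proof -
    \<comment> \<open>The derivatives of L^n, \<open>L\<close> and \<open>l\<close> all come from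
      differentiating L^n (1 - Z) = 1.\<close>
    have "0 = fps_XD (L ^ n * (1 - Z))"
      unfolding LZ by (simp add: fps_XD_one)
    also have "\<dots> = fps_XD (L ^ n) * (1 - Z) - L ^ n * Z"
      using XDZ by (simp add: fps_XD_def algebra_simps)
    finally have "fps_XD (L ^ n) * (1 - Z) = (L ^ n * Z) * (L ^ n * (1 - Z))"
      using LZ by simp
    then have "fps_XD (L ^ n) * (1 - Z) = (L ^ n * Z * L ^ n) * (1 - Z)"
      by (simp only: mult.assoc)
    then show ?thesis
      using \<open>1 - Z \<noteq> 0\<close> LnZ by simp
  qed
  show XDL: "fps_XD L = l * L"
  proof -
    obtain k where k: "n = Suc k"
      using n by (cases n) auto
    have "fps_XD (L ^ n) = N * L ^ k * fps_XD L"
      unfolding k N_def by (simp add: fps_XD_def fps_deriv_power' mult_ac del: power_Suc)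
    then have "(N * L ^ k) * fps_XD L = (N * L ^ k) * (l * L)"
      using XDLn by (simp add: k algebra_simps)
    then show ?thesis
      using N_nz L_nz[of 1] by simp
  qed
  have XDl: "fps_XD l = l * L ^ n"
  proof -
    have "N * fps_XD l = fps_XD (N * l)"
      by (simp add: N_def fps_XD_def)
    also have "\<dots> = N * (l * L ^ n)"
      unfolding Nl using XDLn by (simp add: fps_XD_def algebra_simps)
    finally show ?thesis
      using N_nz by simp
  qed

  have A: "2 * L * A c k = L ^ k * (2 * of_nat k * wcoeff 1 Y + of_nat k * (of_nat k - 1) * l +
      of_nat k * (of_nat k + 1) * fps_const c)" for c k
    by (rule WKB_order_1[OF XDL])
      (simp_all add: A_def wcoeff_1 wcoeff_riccati(2)[OF Y] R0 YL del: riccati.simps(2) of_nat_Suc)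
  have A_eq: "A 0 n = Z * A (1 / of_nat n) n"
    using ord[of 1] by (simp add: A_def wcoeff_1)
  \<comment> \<open>The bracket in the order 1 formula for c = 0. For c = 1/n it grows by N (N + 1)
    C = N + 1.\<close>
  define V where "V = 2 * N * wcoeff 1 Y + N * (N - 1) * l"
  have "L ^ n * (L ^ n * V) = L ^ n * (2 * L * A 0 n)"
    unfolding A V_def N_def by simp
  also have "\<dots> = (L ^ n * Z) * (2 * L * A (1 / of_nat n) n)"
    by (simp add: A_eq)
  also have "\<dots> = (N * l) * (L ^ n * (V + (N + 1)))"
    unfolding A LnZ C_def[symmetric] using NC by (simp add: V_def N_def[symmetric] algebra_simps)
  finally have "L ^ n * (L ^ n * V) = L ^ n * (N * l * (V + (N + 1)))"
    by (simp only: mult_ac)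
  then have "(N * l + 1) * V = N * l * (V + (N + 1))"
    unfolding mult_left_cancel[OF L_nz] unfolding Ln .
  then have "(2 * N) * wcoeff 1 Y = (2 * N) * l"
    by (simp add: V_def algebra_simps)
  then show Yl: "wcoeff 1 Y = l"
    using N_nz by simp

  define P where "P = (N - 1) * N * (N + 1)"
  have B: "24 * L^2 * B c k = L ^ k * (24 * of_nat k * wcoeff 2 Y * L +
    (of_nat k - 1) * of_nat k * (of_nat k + 1) *
      ((3 * of_nat k - 2) * l * (l + fps_const c) + 4 * l * L ^ n +
       (3 * of_nat k + 2) * fps_const c * (l + fps_const c)))" for c k
  proof (rule WKB_order_2[OF XDL XDl, of "fps_const c" "A c"])
    fix k
    show "2 * L * A c k = L ^ k * (of_nat k * (of_nat k + 1) * (l + fps_const c))"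
      unfolding A Yl by (simp add: algebra_simps)
  qed (simp_all add: A_def B_def fps_XD_const wcoeff_1 wcoeff_riccati(3)[OF Y] R0 YL Yl
      del: riccati.simps(2) of_nat_Suc)
  have B_eq: "B 0 n = Z * B (1 / of_nat n) n"
    using ord[of 2] by (simp add: B_def wcoeff_1)
  \<comment> \<open>The order 2 bracket for c = 0, again the part common to both values of
    \<open>c\<close>.\<close>
  define W where "W = 24 * N * wcoeff 2 Y * L + P * ((3 * N - 2) * l * l + 4 * l * L ^ n)"
  have "L ^ n * (L ^ n * W) = L ^ n * (24 * L^2 * B 0 n)"
    unfolding B W_def P_def N_def by simp
  also have "\<dots> = (L ^ n * Z) * (24 * L^2 * B (1 / of_nat n) n)"
    by (simp add: B_eq)
  also have "\<dots> = (N * l) * (L ^ n * (W + P * ((3 * N - 2) * l * C + (3 * N + 2) * C * (l + C))))"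
    unfolding B LnZ C_def[symmetric] by (simp add: W_def P_def N_def[symmetric] algebra_simps)
  finally have "L ^ n * (L ^ n * W) =
      L ^ n * (N * l * (W + P * ((3 * N - 2) * l * C + (3 * N + 2) * C * (l + C))))"
    by (simp only: mult_ac)
  then have "(N * l + 1) * W = N * l * (W + P * ((3 * N - 2) * l * C + (3 * N + 2) * C * (l + C)))"
    unfolding mult_left_cancel[OF L_nz] unfolding Ln .
  also have "\<dots> =
      N * l * W + l * P * ((3 * N - 2) * l * (N * C) + (3 * N + 2) * (N * C) * (l + C))"
    by (simp only: algebra_simps)
  finally have "(N * l + 1) * W =
      N * l * W + l * P * ((3 * N - 2) * l * (N * C) + (3 * N + 2) * (N * C) * (l + C))" .
  then have "W = l * P * ((3 * N - 2) * l + (3 * N + 2) * (l + C))"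
    unfolding NC by (simp add: algebra_simps)
  then have "24 * N * wcoeff 2 Y * L =
      l * P * ((3 * N - 2) * l + (3 * N + 2) * (l + C) - (3 * N - 2) * l - 4 * (N * l + 1))"
    unfolding W_def Nl by (simp add: algebra_simps)
  \<comment> \<open>After taking out l (N - 1) (N + 1) there remains N (2 - N) l - 4 N + 3 N + 2 =
    (2 - N) (N l + 1), the origin of the factor n - 2.\<close>
  also have "\<dots> = - (l * (N - 1) * (N + 1) * (N - 2) * (N * l + 1))"
  proof -
    have PC: "P * C = (N - 1) * (N + 1)"
      using NC by (simp add: P_def mult_ac)
    have "l * P * ((3 * N - 2) * l + (3 * N + 2) * (l + C) - (3 * N - 2) * l - 4 * (N * l + 1)) =
        l * (P * ((3 * N + 2) * l - 4 * (N * l + 1)) + (3 * N + 2) * (P * C))"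
      by (simp add: algebra_simps)
    also have "\<dots> = - (l * (N - 1) * (N + 1) * (N - 2) * (N * l + 1))"
      unfolding PC by (simp add: P_def algebra_simps)
    finally show ?thesis .
  qed
  finally show "24 * of_nat n * wcoeff 2 Y * L =
      - ((of_nat n - 1) * (of_nat n + 1) * (of_nat n - 2) * l * L ^ n)"
    unfolding Ln[symmetric] by (simp add: N_def mult_ac)
qed

section \<open>Integrality of the binomial series\<close>

interpretation Ints: coefficient_ring "\<int> :: rat set"
  by unfold_locales auto

text \<open>In z * z^(k-1) both factors have constant term 0, so the two extreme terms of the
  convolution vanish.\<close>

lemma Ints_power_nth:
  fixes z :: "rat fps"
  assumes z: "coeffs_below \<int> d z" and z0: "z $ 0 = 0" and d: "d > 0" and k: "k \<ge> 2"
  shows "(z ^ k) $ d \<in> \<int>"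
proof -
  obtain i where i: "k = Suc (Suc i)"
    using k by (metis Suc_le_D numeral_2_eq_2 Suc_le_mono)
  have "(z * z ^ Suc i) $ d - (z $ 0 * (z ^ Suc i) $ d + z $ d * (z ^ Suc i) $ 0) \<in> \<int>"
    by (intro Ints.mult_nth_mod Ints.coeffs_below_power z d)
  then show ?thesis
    by (simp add: i z0)
qed

text \<open>
  For \<open>n \<ge> 2\<close> put \<open>L = 1 + n z\<close>.  After division by \<open>n\<^sup>2\<close>, the equation \<open>L\<^sup>n (1 - n\<^sup>n x) = 1\<close>
  expresses \<open>z\<close> as an integral series plus an integral combination of \<open>z\<^sup>2, \<dots>, z\<^sup>n\<close>.
\<close>

lemma L_series_integral:
  fixes n :: nat
  assumes n: "n > 0"
  shows "L_series n $ d \<in> \<int>"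
proof -
  have Ln: "(L_series n ^ n) $ d = of_nat n ^ (n * d)" for d
  proof -
    have "L_series n ^ n = Abs_fps (\<lambda>d. (of_nat n ^ n) ^ d)"
    proof -
      have "(1 - fps_const (of_nat n ^ n) * fps_X) * Abs_fps (\<lambda>d. (of_nat n ^ n :: rat) ^ d) = 1"
      proof (rule fps_ext)
        fix d
        show "((1 - fps_const (of_nat n ^ n) * fps_X) * Abs_fps (\<lambda>d. (of_nat n ^ n :: rat) ^ d)) $ d
            = 1 $ d"
          by (cases d) (simp_all add: left_diff_distrib mult.assoc)
      qed
      then have "L_series n ^ n * ((1 - fps_const (of_nat n ^ n) * fps_X) *
          Abs_fps (\<lambda>d. (of_nat n ^ n :: rat) ^ d)) = L_series n ^ n"
        by simp
      then show ?thesis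
        unfolding mult.assoc[symmetric] L_series_power[OF n] by simp
    qed
    then show ?thesis
      by (simp add: power_mult)
  qed
  show ?thesis
  proof (cases "n = 1")
    case True
    then show ?thesis
      using Ln[of d] by simp
  next
    case False
    then have n2: "n \<ge> 2"
      using n by simp
    define N :: "rat fps" where "N = fps_const (of_nat n)"
    define z where "z = fps_const (1 / of_nat n) * (L_series n - 1)"
    have L: "L_series n = N * z + 1"
      using n by (simp add: z_def N_def mult.assoc[symmetric])
    have z0: "z $ 0 = 0"
      by (simp add: z_def L_series_nth_0)
    have "z $ d \<in> \<int>" for d
    proof (induction d rule: less_induct)
      case (less d)
      show ?case
      proof (cases "d = 0")
        case False
        then have d: "d > 0"
          by simp
        \<comment> \<open>The term k = 1 gives n^2 z, and each term with k >= 2 carries n^k, so n^2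
          divides all of them.\<close>
        have split: "{..n} = insert 0 (insert 1 {2..n})"
          using n2 by auto
        have "L_series n ^ n = (\<Sum>k\<le>n. of_nat (n choose k) * (N * z) ^ k)"
          unfolding L by (subst binomial_ring) simp
        also have "\<dots> = 1 + (of_nat n * N * z + (\<Sum>k = 2..n. of_nat (n choose k) * (N * z) ^ k))"
          unfolding split using n2 by simp
        finally have "(L_series n ^ n) $ d = (of_nat n * N * z) $ d +
            (\<Sum>k = 2..n. of_nat (n choose k) * (N * z) ^ k) $ d"
          using d by simp
        also have "(of_nat n * N * z) $ d = of_nat n ^ 2 * z $ d"
          by (simp add: N_def mult.assoc power2_eq_square)
        also have "(\<Sum>k = 2..n. of_nat (n choose k) * (N * z) ^ k) $ d =
            of_nat n ^ 2 * (\<Sum>k = 2..n. of_nat (n choose k) * of_nat n ^ (k - 2) * (z ^ k) $ d)"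
          unfolding fps_sum_nth sum_distrib_left
        proof (rule sum.cong[OF refl])
          fix k assume "k \<in> {2..n}"
          then have "2 + (k - 2) = k"
            by auto
          then have "(of_nat n ^ k :: rat) = of_nat n ^ 2 * of_nat n ^ (k - 2)"
            by (metis power_add)
          then show "(of_nat (n choose k) * (N * z) ^ k) $ d =
              of_nat n ^ 2 * (of_nat (n choose k) * of_nat n ^ (k - 2) * (z ^ k) $ d)"
            by (simp add: N_def power_mult_distrib fps_const_power)
        qed
        also have "(L_series n ^ n) $ d = of_nat n ^ 2 * of_nat n ^ (n * d - 2)"
        proof -
          \<comment> \<open>Makes the left coefficient n^(n d) divisible by n^2 as well.\<close>
          have "2 \<le> n * d"
            using n2 d by (metis One_nat_def Suc_leI mult.right_neutral mult_le_mono)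
          then have "2 + (n * d - 2) = n * d"
            by auto
          then show ?thesis
            unfolding Ln by (metis power_add)
        qed
        finally have "z $ d = of_nat n ^ (n * d - 2) -
            (\<Sum>k = 2..n. of_nat (n choose k) * of_nat n ^ (k - 2) * (z ^ k) $ d)"
          using n unfolding distrib_left[symmetric] by simp
        moreover have "coeffs_below \<int> d z"
          using less by (simp add: coeffs_below_def)
        then have "(\<Sum>k = 2..n. of_nat (n choose k) * of_nat n ^ (k - 2) * (z ^ k) $ d) \<in> \<int>"
          by (intro Ints.sum_closed Ints.mult_closed Ints.power_closed Ints.of_nat_closed
              Ints_power_nth z0 d) simp_all
        ultimately show ?thesis
          by (simp add: Ints.diff_closed Ints.power_closed)
      qed (simp add: z0)
    qed
    then show ?thesis
      by (simp add: L N_def Ints.add_closed Ints.mult_closed)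
  qed
qed

section \<open>The asymptotic expansion\<close>

lemma fps_exp_compose_regular:
  assumes "regular_series f"
  shows "regular_series (fps_exp 1 oo f)"
  unfolding regular_series_def
proof
  fix d
  \<comment> \<open>The reciprocal is taken in the field of Laurent series; it must be recognized as
    a rational constant to be regular.\<close>
  have inv_fact: "(1 / fact i :: rat fls) = fls_const (1 / fact i)" for i
  proof -
    have "(fact i :: rat fls) = fls_const (fact i)"
      by (metis fls_of_nat of_nat_fact)
    moreover have "fls_const (fact i) * fls_const (1 / fact i) = (1 :: rat fls)"
      by (simp add: fls_const_mult_const)
    ultimately show ?thesis
      by (simp add: field_simps)
  qed
  have "coeffs_below regular (Suc d) (f ^ i)" for i
    using assms by (auto simp: regular_series_iff intro: regular.coeffs_below_power)
  then have "(f ^ i) $ d \<in> regular" for i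
    by (simp add: coeffs_below_def)
  then show "(fps_exp 1 oo f) $ d \<in> regular"
    by (auto simp: fps_compose_nth inv_fact
        intro!: regular.sum_closed regular.mult_closed fls_const_regular)
qed

theorem theorem3:
  fixes n :: nat
  assumes "n > 0"
  shows "(\<forall>k. fps_nth (L_series n) k \<in> \<int>) \<and>
    has_expansion (calF n) (mu n) (Phi n) \<and>
    mu n = fps_integral0 ((L_series n - 1) / fps_X) \<and>
    Phi n 0 = L_series n \<and>
    Phi n 1 =
      fps_const ((of_nat n - 2) * (of_nat n + 1) / (24 * of_nat n)) *
        (L_series n - L_series n ^ n)"
proof -
  define E where "E = expand_coeffs (log_calF n)"
  define G where "G = expand_coeffs (calF n)"
  note EG = expand_log_calF[of n, folded E_def G_def]
  define Y where "Y = 1 + fps_const fls_X * fps_XD E"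
  define L where "L = L_series n"
  define l where "l = fps_const (1 / of_nat n) * (L ^ n - 1)"
  have Y0: "Y $ 0 = 1"
    by (simp add: Y_def)
  note eq = riccati_equation[OF assms, folded E_def, folded Y_def]
  have Y: "regular_series Y"
    using riccati_solution_regular[OF assms Y0 eq] by (simp add: regular_series_def)
  note WKB = WKB_solution[OF assms Y Y0 eq, folded L_def, folded l_def]
  have mu_coeff: "mu_coeff n j = wcoeff j E" for j
    by (simp add: mu_coeff_def wcoeff_def E_def expand_coeffs_nth)
  \<comment> \<open>Orders 0, 1, 2 of Y = 1 + w^-1 x d/dx log F.\<close>
  have XD_mu: "fps_XD (mu n) = L - 1"
    "fps_XD (mu_coeff n 0) = l" "fps_XD (mu_coeff n 1) = wcoeff 2 Y"
    unfolding mu_def mu_coeff WKB(1)[symmetric] WKB(2)[symmetric]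
    by (simp_all add: Y_def wcoeff_add wcoeff_1 wcoeff_winv_times wcoeff_XD)
  have mu0: "mu n $ 0 = 0"
    by (simp add: mu_def mu_coeff wcoeff_nth EG)

  define M where "M = Abs_fps (\<lambda>d. fls_const (fps_nth (mu n) d) * fls_X_inv)"
  define N where "N = winv_series (\<lambda>j. mu_coeff n (int j))"
  \<comment> \<open>Regularity of \<open>Y\<close> bounds d E_d / w, and d is invertible for d >
    0.\<close>
  have E_low: "fls_nth (E $ d) j = 0" if "j < -1" for d j
  proof (cases "d = 0")
    case False
    have "Y $ d \<in> regular"
      using Y by (simp add: regular_series_def)
    then have "fls_nth (Y $ d) (j + 1) = 0"
      using that by auto
    then show ?thesis
      using False by (simp add: Y_def fls_X_times_conv_shift)
  qed (simp add: EG)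
  \<comment> \<open>log F is the term mu w plus a part without positive powers of w.\<close>
  have E_split: "E = M + N"
  proof (rule fps_ext, rule fls_eqI)
    fix d j
    show "fls_nth (E $ d) j = fls_nth ((M + N) $ d) j"
      using E_low[of j d]
      by (cases "j < -1"; cases "j = -1")
        (auto simp: M_def N_def winv_series_def mu_def mu_coeff wcoeff_nth fls_X_inv_times_conv_shift)
  qed
  have M0: "M $ 0 = 0"
    by (simp add: M_def mu0)
  have N0: "N $ 0 = 0"
    using E_split M0 EG(2) by simp
  have N_reg: "regular_series N"
    by (simp add: N_def winv_series_def regular_series_def)
  define K where "K = fps_exp 1 oo N"
  have K_reg: "regular_series K"
    unfolding K_def by (rule fps_exp_compose_regular[OF N_reg])
  have Phi: "Phi n s = wcoeff (int s) K" for s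
    by (simp add: Phi_def wcoeff_def K_def N_def)
  \<comment> \<open>\<open>winv_series\<close> sees only nonnegative powers of w^-1; by regularity
    of \<open>K\<close> nothing is lost.\<close>
  have winv_Phi: "winv_series (Phi n) = K"
  proof (rule fps_ext, rule fls_eqI)
    fix d j
    show "fls_nth (winv_series (Phi n) $ d) j = fls_nth (K $ d) j"
      using K_reg by (auto simp: winv_series_def Phi wcoeff_nth regular_series_def image_iff)
        (metis fps_to_fls_nth)
  qed
  have "fps_exp 1 oo E = G"
    by (rule fps_exp_compose_unique) (simp_all add: EG)
  then have expansion: "has_expansion (calF n) (mu n) (Phi n)"
    unfolding has_expansion_def winv_Phi using M0 N0
    by (simp add: mu0 M_def[symmetric] expand_coeffs_def[symmetric] G_def[symmetric] K_def
        E_split fps_exp_compose_add)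

  have mu: "mu n = fps_integral0 ((L - 1) / fps_X)"
  proof (rule fps_ext)
    fix d
    show "mu n $ d = fps_integral0 ((L - 1) / fps_X) $ d"
      using arg_cong[OF XD_mu(1), of "\<lambda>f. f $ d"]
      by (cases d) (simp_all add: mu0 field_simps del: of_nat_Suc)
  qed

  have XD_K: "fps_XD K = fps_XD N * K"
    unfolding K_def by (rule fps_XD_exp_compose[OF N0])
  have wN: "wcoeff (int s) N = mu_coeff n (int s)" for s
    by (simp add: fps_eq_iff wcoeff_nth N_def winv_series_def)
  have K0: "K $ 0 = 1"
    by (simp add: K_def)
  have L_nth_0: "L $ 0 = 1"
    by (simp add: L_def L_series_nth_0)
  have l0: "l $ 0 = 0"
    by (simp add: l_def L_nth_0 fps_power_zeroth)
  have Phi_nth_0: "Phi n s $ 0 = (if s = 0 then 1 else 0)" for s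
    by (simp add: Phi wcoeff_nth K0)
  \<comment> \<open>Orders 0 and 1 of the equation for \<open>K\<close>, with the derivatives of
    mu_0 and mu_1 inserted.\<close>
  have XD_Phi: "fps_XD (Phi n 0) = l * Phi n 0"
    "fps_XD (Phi n 1) = l * Phi n 1 + wcoeff 2 Y * Phi n 0"
    using wcoeff_mult_012(1,2)[OF regular_series_XD[OF N_reg] K_reg, folded XD_K] wN[of 0] wN[of 1]
    by (simp_all add: wcoeff_XD Phi XD_mu)
  have Phi0: "Phi n 0 = L"
    by (rule fps_XD_linear_ODE_unique[where h = l and k = 0])
      (simp_all add: XD_Phi WKB(3) l0 Phi_nth_0 L_nth_0)

  define c :: "rat fps" where "c = fps_const ((of_nat n - 2) * (of_nat n + 1) / (24 * of_nat n))"
  have c: "24 * of_nat n * c = (of_nat n - 2) * (of_nat n + 1)"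
  proof -
    have "24 * of_nat n * c = fps_const (24 * of_nat n *
        ((of_nat n - 2) * (of_nat n + 1) / (24 * of_nat n)))"
      by (simp add: c_def fps_of_nat[symmetric] numeral_fps_const)
    also have "\<dots> = fps_const ((of_nat n - 2) * (of_nat n + 1))"
      using assms by simp
    also have "\<dots> = (of_nat n - 2) * (of_nat n + 1)"
      by (simp add: fps_of_nat[symmetric] numeral_fps_const flip: fps_const_1_eq_1)
    finally show ?thesis .
  qed
  have XD_Ln: "fps_XD (L ^ n) = of_nat n * l * L ^ n"
    by (rule fps_XD_power[OF WKB(3)])
  have "24 * of_nat n * fps_XD (c * (L - L ^ n)) =
      (24 * of_nat n * c) * (l * L - of_nat n * l * L ^ n)"
    unfolding c_def fps_XD_mult_const fps_XD_diff XD_Ln WKB(3) by (simp only: mult.assoc)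
  \<comment> \<open>The defect of c (L - L^n) in the homogeneous equation is c l (1 - n) L^n, which
    equals Y_2 L by the order 2 formula.\<close>
  also have "\<dots> = l * (24 * of_nat n * c) * (L - L ^ n) + 24 * of_nat n * wcoeff 2 Y * L"
    unfolding c WKB(4) by (simp add: algebra_simps)
  also have "\<dots> = 24 * of_nat n * (l * (c * (L - L ^ n)) + wcoeff 2 Y * L)"
    by (simp add: algebra_simps)
  finally have XD_T: "fps_XD (c * (L - L ^ n)) = l * (c * (L - L ^ n)) + wcoeff 2 Y * L"
    using assms by simp
  have Phi1: "Phi n 1 = c * (L - L ^ n)"
    by (rule fps_XD_linear_ODE_unique[where h = l and k = "wcoeff 2 Y * L"])
      (use XD_Phi(2) XD_T Phi0 in
        \<open>simp_all add: l0 Phi_nth_0 L_nth_0 fps_power_zeroth\<close>)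
  show ?thesis
    using L_series_integral[OF assms] expansion mu Phi0 Phi1 by (simp add: L_def c_def)
qed

end
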